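(* For all integers $k\ge 2$ and $d\ge 1$, $d(k,[k]^d)=\left(1-\frac{2}{k}\right)^{d}$.
   Context: Notation: $[n]=\{1,\dots,n\}$. Let $k\ge 2$ and $d\ge 1$ be integers. The board $B=[k]^d\subseteq\mathbb{Z}^d$ has as its $k$-lines all sets $\{p+j\vec v: 0\le j\le k-1\}$ with $p\in B$ and $\vec v\in\{-1,0,1\}^d\setminus\{0\}$ that are contained in $B$. A configuration of $B$ is a subset $S\subseteq B$ with $|L\setminus S|\ge 2$ for every $k$-line $L$ of $B$. A saturated configuration is a configuration that is maximal with respect to inclusion among configurations; $\mathcal{S}_k(B)$ is the set of saturated configurations. The quantity $d(k,B)$ (not to be confused with the dimension $d$) is $d(k,B)=\min_{S\in\mathcal{S}_k(B)}|S|/|B|$. *)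

theory Defs
  imports Complex_Main "HOL-Library.FuncSet"
begin

(* Vectors of Z^d are functions in {1..d} \<rightarrow>\<^sub>E UNIV, i.e. they are undefined outside
   {1..d}; hence addition and the zero vector are restricted to {1..d}. *)

definition board :: "nat \<Rightarrow> nat \<Rightarrow> (nat \<Rightarrow> int) set" where
  "board k d = {1..d} \<rightarrow>\<^sub>E {1..int k}"

definition directions :: "nat \<Rightarrow> (nat \<Rightarrow> int) set" where
  "directions d = ({1..d} \<rightarrow>\<^sub>E {-1, 0, 1}) - {\<lambda>i\<in>{1..d}. 0}"

definition line_points :: "nat \<Rightarrow> nat \<Rightarrow> (nat \<Rightarrow> int) \<Rightarrow> (nat \<Rightarrow> int) \<Rightarrow> (nat \<Rightarrow> int) set" where
  "line_points k d p v = (\<lambda>j. \<lambda>i\<in>{1..d}. p i + int j * v i) ` {0..k - 1}"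

definition k_lines :: "nat \<Rightarrow> nat \<Rightarrow> (nat \<Rightarrow> int) set \<Rightarrow> (nat \<Rightarrow> int) set set" where
  "k_lines k d B = {L. L \<subseteq> B \<and> (\<exists>p\<in>B. \<exists>v\<in>directions d. L = line_points k d p v)}"

definition configuration :: "nat \<Rightarrow> nat \<Rightarrow> (nat \<Rightarrow> int) set \<Rightarrow> (nat \<Rightarrow> int) set \<Rightarrow> bool" where
  "configuration k d B S \<longleftrightarrow> S \<subseteq> B \<and> (\<forall>L\<in>k_lines k d B. card (L - S) \<ge> 2)"

definition saturated_configurations ::
    "nat \<Rightarrow> nat \<Rightarrow> (nat \<Rightarrow> int) set \<Rightarrow> (nat \<Rightarrow> int) set set" where
  "saturated_configurations k d B =
     {S. configuration k d B S \<and> (\<forall>T. configuration k d B T \<and> S \<subseteq> T \<longrightarrow> T = S)}"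

definition min_saturated_density :: "nat \<Rightarrow> nat \<Rightarrow> (nat \<Rightarrow> int) set \<Rightarrow> real" where
  "min_saturated_density k d B =
     Min ((\<lambda>S. real (card S) / real (card B)) ` saturated_configurations k d B)"

end

theory Submission
  imports Defs
begin

text \<open>
  The minimum is attained by the inner cube \<open>{2..k-1}\<^sup>d\<close>, which has \<open>(k-2)\<^sup>d\<close> points.

  Each line contained in the board runs from boundary to boundary: a moving coordinate takes all
  values \<open>1..k\<close>, so the two ends of the line lie outside the inner cube.  Hence the inner cube is a
  configuration.  Conversely, from a boundary point one can walk inwards, moving exactly the
  coordinates that lie in \<open>{1, k}\<close>; this walk is a line whose points other than the two ends are
  inner points.  No boundary point can therefore be added to the inner cube, which is thus saturated
  (\<open>inner_saturated\<close>).

  For the lower bound, let \<open>S\<close> be saturated.  Send \<open>x \<in> S\<close> to the first point outside \<open>S\<close> on the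
  walk inwards from \<open>x\<close>.  This map covers all inner points (\<open>inner_subset_first_free\<close>), so
  \<open>|S| \<ge> (k-2)\<^sup>d\<close>.  Indeed, inner points of \<open>S\<close> do not move at all.  If \<open>u \<notin> S\<close> is
  inner, then maximality of \<open>S\<close> yields a line through \<open>u\<close> with exactly two points outside \<open>S\<close>, namely
  \<open>u\<close> and some \<open>u'\<close>.  Let \<open>x\<close> be the end of the line from which \<open>u\<close> is reached before \<open>u'\<close>; it
  differs from the inner point \<open>u\<close>.  Then \<open>x \<in> S\<close>, the walk inwards from \<open>x\<close> is this very line because the
  coordinates that do not move agree with those of the inner point \<open>u\<close>, and \<open>u\<close> is its first point
  outside \<open>S\<close>.
\<close>

section \<open>Lines and the walk inwards\<close>

definition inner :: "nat \<Rightarrow> nat \<Rightarrow> (nat \<Rightarrow> int) set" where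
  "inner k d = {1..d} \<rightarrow>\<^sub>E {2..int k - 1}"

definition step :: "nat \<Rightarrow> (nat \<Rightarrow> int) \<Rightarrow> (nat \<Rightarrow> int) \<Rightarrow> nat \<Rightarrow> (nat \<Rightarrow> int)" where
  "step d p v j = (\<lambda>i\<in>{1..d}. p i + int j * v i)"

definition inward :: "nat \<Rightarrow> nat \<Rightarrow> (nat \<Rightarrow> int) \<Rightarrow> (nat \<Rightarrow> int)" where
  "inward k d x = (\<lambda>i\<in>{1..d}. if x i = 1 then 1 else if x i = int k then -1 else 0)"

text \<open>
  For an inner point \<open>x\<close> the walk is constant, so the value is \<open>x\<close> whatever the unspecified
  \<open>LEAST\<close> may be.
\<close>

definition first_free :: "nat \<Rightarrow> nat \<Rightarrow> (nat \<Rightarrow> int) set \<Rightarrow> (nat \<Rightarrow> int) \<Rightarrow> (nat \<Rightarrow> int)" where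
  "first_free k d S x = step d x (inward k d x) (LEAST j. step d x (inward k d x) j \<notin> S)"

lemma line_points_step: "line_points k d p v = step d p v ` {0..k - 1}"
  by (simp add: line_points_def step_def[abs_def])

lemma inner_subset_board: "inner k d \<subseteq> board k d"
  unfolding inner_def board_def by (rule PiE_mono) auto

lemma finite_board: "finite (board k d)"
  unfolding board_def by (intro finite_PiE) auto

lemma step_0:
  assumes "p \<in> board k d"
  shows "step d p v 0 = p"
  using assms by (auto simp: step_def board_def PiE_iff extensional_def fun_eq_iff)

lemma directions_range:
  assumes "v \<in> directions d" "i \<in> {1..d}"
  shows "v i = -1 \<or> v i = 0 \<or> v i = 1"
  using assms by (auto simp: directions_def PiE_iff)

lemma directions_moving_coordinate:
  assumes "v \<in> directions d"
  obtains i where "i \<in> {1..d}" "v i = -1 \<or> v i = 1"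
proof -
  have "\<exists>i\<in>{1..d}. v i \<noteq> 0"
  proof (rule ccontr)
    assume "\<not> ?thesis"
    then have "v = (\<lambda>i\<in>{1..d}. 0)"
      using assms by (auto simp: directions_def PiE_iff extensional_def fun_eq_iff)
    then show False using assms by (simp add: directions_def)
  qed
  then show ?thesis using that directions_range[OF assms] by blast
qed

lemma step_inj:
  assumes "v \<in> directions d" "step d p v j = step d p v j'"
  shows "j = j'"
proof -
  obtain i where i: "i \<in> {1..d}" "v i = -1 \<or> v i = 1"
    using directions_moving_coordinate[OF assms(1)] .
  from assms(2) have "step d p v j i = step d p v j' i" by simp
  then show ?thesis using i by (auto simp: step_def)
qed

text \<open>
  A line contained in the board is as long as the board is wide, so a moving coordinate has no
  choice but to start at one side and to end at the opposite side.
\<close>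

lemma moving_coordinate_start:
  assumes k: "k \<ge> 2" and p: "p \<in> board k d"
    and L: "line_points k d p v \<subseteq> board k d" and i: "i \<in> {1..d}"
  shows "v i = 1 \<Longrightarrow> p i = 1" and "v i = -1 \<Longrightarrow> p i = int k"
proof -
  have "step d p v (k - 1) \<in> board k d"
    using L by (auto simp: line_points_step)
  then have "step d p v (k - 1) i \<in> {1..int k}"
    using i unfolding board_def by (rule PiE_mem)
  moreover have "step d p v (k - 1) i = p i + (int k - 1) * v i"
    using i k by (simp add: step_def of_nat_diff)
  ultimately have e: "p i + (int k - 1) * v i \<in> {1..int k}" by simp
  have q: "p i \<in> {1..int k}" using p i unfolding board_def by (rule PiE_mem)
  show "p i = 1" if "v i = 1" using e q that by auto
  show "p i = int k" if "v i = -1" using e q that by auto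
qed

lemma line_ends_not_inner:
  assumes k: "k \<ge> 2" and p: "p \<in> board k d" and v: "v \<in> directions d"
    and L: "line_points k d p v \<subseteq> board k d"
  shows "step d p v 0 \<notin> inner k d" and "step d p v (k - 1) \<notin> inner k d"
proof -
  obtain i where i: "i \<in> {1..d}" and vi: "v i = -1 \<or> v i = 1"
    using directions_moving_coordinate[OF v] .
  have s: "v i = 1 \<and> p i = 1 \<or> v i = -1 \<and> p i = int k"
    using moving_coordinate_start[OF k p L i] vi by auto
  have mem: "x i \<in> {2..int k - 1}" if "x \<in> inner k d" for x
    using that i unfolding inner_def by (rule PiE_mem)
  show "step d p v 0 \<notin> inner k d"
    using mem[of "step d p v 0"] s i by (auto simp: step_def)
  show "step d p v (k - 1) \<notin> inner k d"
    using mem[of "step d p v (k - 1)"] s i k by (auto simp: step_def of_nat_diff)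
qed

lemma step_reverse:
  assumes "j \<le> k - 1"
  shows "step d (step d p v (k - 1)) (\<lambda>i\<in>{1..d}. - v i) j = step d p v (k - 1 - j)"
proof -
  have "int (k - 1) = int (k - 1 - j) + int j" using assms by (simp only: of_nat_diff)
  then show ?thesis by (simp only: step_def) (auto simp: fun_eq_iff algebra_simps)
qed

lemma line_points_reverse:
  "line_points k d (step d p v (k - 1)) (\<lambda>i\<in>{1..d}. - v i) = line_points k d p v"
proof -
  have "line_points k d (step d p v (k - 1)) (\<lambda>i\<in>{1..d}. - v i)
      = (\<lambda>j. step d p v (k - 1 - j)) ` {0..k - 1}"
    unfolding line_points_step by (rule image_cong[OF refl], rule step_reverse) simp
  also have "\<dots> = step d p v ` (\<lambda>j. k - 1 - j) ` {0..k - 1}"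
    by (simp add: image_image)
  also have "(\<lambda>j. k - 1 - j) ` {0..k - 1} = {0..k - 1}"
  proof
    show "{0..k - 1} \<subseteq> (\<lambda>j. k - 1 - j) ` {0..k - 1}"
    proof
      fix x assume "x \<in> {0..k - 1}"
      then show "x \<in> (\<lambda>j. k - 1 - j) ` {0..k - 1}"
        by (intro image_eqI[where x = "k - 1 - x"]) auto
    qed
  qed auto
  finally show ?thesis by (simp only: line_points_step)
qed

lemma directions_reverse:
  assumes "v \<in> directions d"
  shows "(\<lambda>i\<in>{1..d}. - v i) \<in> directions d"
proof -
  obtain i where i: "i \<in> {1..d}" "v i = -1 \<or> v i = 1"
    using directions_moving_coordinate[OF assms] .
  have "(\<lambda>i\<in>{1..d}. - v i) \<noteq> (\<lambda>i\<in>{1..d}. 0)"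
  proof
    assume "(\<lambda>i\<in>{1..d}. - v i) = (\<lambda>i\<in>{1..d}. 0)"
    from fun_cong[OF this, of i] i show False by auto
  qed
  moreover have "(\<lambda>i\<in>{1..d}. - v i) \<in> {1..d} \<rightarrow>\<^sub>E {-1, 0, 1}"
    using directions_range[OF assms] by (fastforce simp: PiE_iff)
  ultimately show ?thesis by (simp add: directions_def)
qed

text \<open>
  A line through an inner point is recovered from either of its ends: the coordinates that stay
  fixed avoid \<open>{1, k}\<close>, and the others start in \<open>{1, k}\<close>.
\<close>

lemma inward_line_start:
  assumes k: "k \<ge> 2" and p: "p \<in> board k d" and v: "v \<in> directions d"
    and L: "line_points k d p v \<subseteq> board k d" and u: "step d p v j \<in> inner k d"
  shows "inward k d p = v"
proof
  fix i
  show "inward k d p i = v i"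
  proof (cases "i \<in> {1..d}")
    case False
    then show ?thesis
      using v by (auto simp: inward_def directions_def PiE_iff extensional_def)
  next
    case i: True
    have "step d p v j i \<in> {2..int k - 1}"
      using u i unfolding inner_def by (rule PiE_mem)
    then have "p i + int j * v i \<in> {2..int k - 1}" using i by (simp add: step_def)
    moreover have "v i = -1 \<or> v i = 0 \<or> v i = 1" by (rule directions_range[OF v i])
    ultimately show ?thesis
      using moving_coordinate_start[OF k p L i] i k by (auto simp: inward_def)
  qed
qed

section \<open>The inner cube is saturated\<close>

lemma inner_configuration:
  assumes k: "k \<ge> 2"
  shows "configuration k d (board k d) (inner k d)"
  unfolding configuration_def
proof (intro conjI ballI inner_subset_board)
  fix L assume "L \<in> k_lines k d (board k d)"
  then obtain p v where LB: "L \<subseteq> board k d" and p: "p \<in> board k d"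
    and v: "v \<in> directions d" and L: "L = line_points k d p v"
    by (auto simp: k_lines_def)
  let ?E = "{step d p v 0, step d p v (k - 1)}"
  have "?E \<subseteq> L - inner k d"
    using line_ends_not_inner[OF k p v] LB L by (auto simp: line_points_step)
  moreover have "finite (L - inner k d)" by (simp add: L line_points_step)
  moreover have "card ?E = 2"
    using step_inj[OF v, of p 0 "k - 1"] k by (auto simp: card_2_iff)
  ultimately show "2 \<le> card (L - inner k d)" by (metis card_mono)
qed

lemma inward_directions:
  assumes k: "k \<ge> 2" and q: "q \<in> board k d" "q \<notin> inner k d"
  shows "inward k d q \<in> directions d"
proof -
  obtain i where i: "i \<in> {1..d}" "q i \<notin> {2..int k - 1}"
    using q by (auto simp: board_def inner_def PiE_iff)
  have "q i \<in> {1..int k}" using q(1) i(1) unfolding board_def by (rule PiE_mem)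
  then have "q i = 1 \<or> q i = int k" using i(2) by auto
  then have "inward k d q i \<noteq> 0" using i(1) by (auto simp: inward_def)
  then have "inward k d q \<noteq> (\<lambda>i\<in>{1..d}. 0)" using i(1) by auto
  moreover have "inward k d q \<in> {1..d} \<rightarrow>\<^sub>E {-1, 0, 1}"
    by (auto simp: inward_def PiE_iff)
  ultimately show ?thesis by (simp add: directions_def)
qed

lemma inward_line_subset_board:
  assumes k: "k \<ge> 2" and q: "q \<in> board k d"
  shows "line_points k d q (inward k d q) \<subseteq> board k d"
proof -
  have "step d q (inward k d q) j \<in> board k d" if "j \<le> k - 1" for j
    using q that k by (auto simp: board_def step_def inward_def PiE_iff of_nat_diff)
  then show ?thesis by (auto simp: line_points_step)
qed

lemma inward_line_inner:
  assumes q: "q \<in> board k d" and j: "0 < j" "j < k - 1"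
  shows "step d q (inward k d q) j \<in> inner k d"
proof -
  have "step d q (inward k d q) j i \<in> {2..int k - 1}" if i: "i \<in> {1..d}" for i
  proof -
    have "q i \<in> {1..int k}" using q i unfolding board_def by (rule PiE_mem)
    then show ?thesis using i j by (auto simp: step_def inward_def)
  qed
  then show ?thesis by (auto simp: inner_def PiE_iff step_def)
qed

lemma inner_saturated:
  assumes k: "k \<ge> 2"
  shows "inner k d \<in> saturated_configurations k d (board k d)"
  unfolding saturated_configurations_def
proof (intro CollectI conjI allI impI inner_configuration[OF k])
  fix T assume T: "configuration k d (board k d) T \<and> inner k d \<subseteq> T"
  show "T = inner k d"
  proof (rule ccontr)
    assume "T \<noteq> inner k d"
    then obtain q where q: "q \<in> T" "q \<notin> inner k d" using T by auto
    have qB: "q \<in> board k d" using q T by (auto simp: configuration_def)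
    let ?v = "inward k d q"
    let ?L = "line_points k d q ?v"
    have "?L \<in> k_lines k d (board k d)"
      using inward_line_subset_board[OF k qB] inward_directions[OF k qB q(2)] qB
      by (auto simp: k_lines_def)
    then have two: "2 \<le> card (?L - T)" using T by (auto simp: configuration_def)
    have "?L - T \<subseteq> {step d q ?v (k - 1)}"
    proof
      fix y assume y: "y \<in> ?L - T"
      then obtain j where j: "j \<le> k - 1" "y = step d q ?v j" by (auto simp: line_points_step)
      have "j \<noteq> 0" using y j q step_0[OF qB] by (metis DiffD2)
      moreover have "\<not> (0 < j \<and> j < k - 1)"
        using inward_line_inner[OF qB] y j(2) T by (metis DiffD2 subsetD)
      ultimately show "y \<in> {step d q ?v (k - 1)}" using j by auto
    qed
    then have "card (?L - T) \<le> card {step d q ?v (k - 1)}" by (intro card_mono) auto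
    then show False using two by simp
  qed
qed

section \<open>Every saturated configuration is at least as large\<close>

text \<open>
  Maximality: adding \<open>u\<close> must spoil some line, and a line can only drop below two free points if
  it had exactly two, \<open>u\<close> being one of them.
\<close>

lemma saturated_tight_line:
  assumes S: "S \<in> saturated_configurations k d (board k d)"
    and u: "u \<in> board k d" "u \<notin> S"
  obtains p v u' where "p \<in> board k d" "v \<in> directions d" "line_points k d p v \<subseteq> board k d"
    "line_points k d p v - S = {u, u'}" "u' \<noteq> u"
proof -
  have conf: "configuration k d (board k d) S"
    and max: "\<And>T. configuration k d (board k d) T \<Longrightarrow> S \<subseteq> T \<Longrightarrow> T = S"
    using S by (auto simp: saturated_configurations_def)
  have "\<not> configuration k d (board k d) (insert u S)"
    using max[of "insert u S"] u by auto
  moreover have "insert u S \<subseteq> board k d" using conf u by (auto simp: configuration_def)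
  ultimately obtain L where L: "L \<in> k_lines k d (board k d)" "\<not> 2 \<le> card (L - insert u S)"
    by (auto simp: configuration_def)
  have two: "2 \<le> card (L - S)" using conf L(1) by (auto simp: configuration_def)
  have uL: "u \<in> L - S"
  proof (rule ccontr)
    assume "u \<notin> L - S"
    then have "L - insert u S = L - S" using u by auto
    then show False using L two by simp
  qed
  have fin: "finite (L - S)" using two card.infinite by force
  have eq: "L - S = insert u (L - insert u S)" using uL by auto
  have "card (L - S) = Suc (card (L - insert u S))"
    using fin by (subst eq, subst card_insert_disjoint) auto
  then have "card (L - insert u S) = 1" using two L(2) by simp
  then obtain u' where u': "L - insert u S = {u'}" by (auto simp: card_1_singleton_iff)
  then have "u' \<noteq> u" by auto
  moreover have "L - S = {u, u'}" using eq u' by simp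
  ultimately show ?thesis using L(1) that by (auto simp: k_lines_def)
qed

lemma first_free_line_start:
  assumes k: "k \<ge> 2" and p: "p \<in> board k d" and v: "v \<in> directions d"
    and L: "line_points k d p v \<subseteq> board k d"
    and free: "line_points k d p v - S = {step d p v j, step d p v j'}"
    and j: "j < j'" "j' \<le> k - 1" and u: "step d p v j \<in> inner k d"
  shows "p \<in> S" and "first_free k d S p = step d p v j"
proof -
  have before: "step d p v i \<in> S" if "i < j" for i
  proof (rule ccontr)
    assume "step d p v i \<notin> S"
    then have "step d p v i \<in> line_points k d p v - S"
      using that j by (auto simp: line_points_step)
    then have "i = j \<or> i = j'" using free step_inj[OF v] by auto
    then show False using that j by simp
  qed
  have "j \<noteq> 0" using line_ends_not_inner(1)[OF k p v L] u by metis
  then show "p \<in> S" using before[of 0] step_0[OF p] by simp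
  have "step d p v j \<notin> S" using free by auto
  then have "(LEAST i. step d p v i \<notin> S) = j"
    using before by (intro Least_equality) (auto simp: not_le[symmetric])
  then show "first_free k d S p = step d p v j"
    using inward_line_start[OF k p v L u] by (simp add: first_free_def)
qed

lemma first_free_inner:
  assumes "x \<in> inner k d"
  shows "first_free k d S x = x"
proof -
  have "step d x (inward k d x) j = x" for j
  proof
    fix i
    show "step d x (inward k d x) j i = x i"
    proof (cases "i \<in> {1..d}")
      case True
      have "x i \<in> {2..int k - 1}" using assms True unfolding inner_def by (rule PiE_mem)
      then show ?thesis using True by (simp add: step_def inward_def)
    next
      case False
      then show ?thesis using assms by (auto simp: step_def inner_def PiE_iff extensional_def)
    qed
  qed
  then show ?thesis by (simp add: first_free_def)
qed

lemma inner_subset_first_free: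
  assumes k: "k \<ge> 2" and S: "S \<in> saturated_configurations k d (board k d)"
  shows "inner k d \<subseteq> first_free k d S ` S"
proof
  fix u assume u: "u \<in> inner k d"
  show "u \<in> first_free k d S ` S"
  proof (cases "u \<in> S")
    case True
    then show ?thesis using first_free_inner[OF u] by (metis image_eqI)
  next
    case False
    have "u \<in> board k d" using u inner_subset_board by auto
    from saturated_tight_line[OF S this False] obtain p v u' where p: "p \<in> board k d"
      and v: "v \<in> directions d" and L: "line_points k d p v \<subseteq> board k d"
      and free: "line_points k d p v - S = {u, u'}" and ne: "u' \<noteq> u" .
    have "u \<in> line_points k d p v" "u' \<in> line_points k d p v" using free by auto
    then obtain j j' where j: "j \<le> k - 1" "u = step d p v j"
      and j': "j' \<le> k - 1" "u' = step d p v j'"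
      by (auto simp: line_points_step)
    from ne j j' have "j \<noteq> j'" by auto
    then consider "j < j'" | "j' < j" by linarith
    then show ?thesis
    proof cases
      case 1
      have "p \<in> S" "first_free k d S p = u"
        using first_free_line_start[OF k p v L, of S j j'] free 1 j j' u by auto
      then show ?thesis by (metis image_eqI)
    next
      case 2
      \<comment> \<open>Here \<open>u\<close> comes first when the line is traversed from its other end.\<close>
      let ?p = "step d p v (k - 1)" and ?v = "\<lambda>i\<in>{1..d}. - v i"
      have p': "?p \<in> board k d" using L by (auto simp: line_points_step)
      have eq: "step d ?p ?v (k - 1 - j) = u" "step d ?p ?v (k - 1 - j') = u'"
        using step_reverse[of "k - 1 - j" k d p v] step_reverse[of "k - 1 - j'" k d p v] j j'
        by (simp_all only: diff_diff_cancel diff_le_self)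
      have "?p \<in> S" "first_free k d S ?p = u"
        using first_free_line_start[OF k p' directions_reverse[OF v],
            of S "k - 1 - j" "k - 1 - j'", unfolded line_points_reverse eq, OF L free _ _ u]
          2 j(1) by linarith+
      then show ?thesis by (metis image_eqI)
    qed
  qed
qed

section \<open>The minimal density\<close>

lemma card_board: "card (board k d) = k ^ d"
  by (simp add: board_def card_PiE)

lemma card_inner: "card (inner k d) = (k - 2) ^ d"
proof -
  have "nat (int k - 2) = k - 2" by simp
  then show ?thesis by (simp add: inner_def card_PiE)
qed

lemma card_inner_le:
  assumes "k \<ge> 2" and S: "S \<in> saturated_configurations k d (board k d)"
  shows "card (inner k d) \<le> card S"
proof -
  have "finite S"
    using S finite_subset[OF _ finite_board[of k d]]
    by (auto simp: saturated_configurations_def configuration_def)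
  then show ?thesis by (rule surj_card_le) (rule inner_subset_first_free[OF assms])
qed

theorem mainTheorem5:
  fixes k d :: nat
  assumes "k \<ge> 2" and "d \<ge> 1"
  shows "min_saturated_density k d (board k d) = (1 - 2 / real k) ^ d"
proof -
  let ?Sat = "saturated_configurations k d (board k d)"
  have "?Sat \<subseteq> Pow (board k d)"
    by (auto simp: saturated_configurations_def configuration_def)
  then have fin: "finite ?Sat" using finite_board finite_subset by blast
  have "min_saturated_density k d (board k d)
      = real (card (inner k d)) / real (card (board k d))"
    unfolding min_saturated_density_def
  proof (rule Min_eqI)
    show "finite ((\<lambda>S. real (card S) / real (card (board k d))) ` ?Sat)" using fin by simp
    show "real (card (inner k d)) / real (card (board k d))
        \<in> (\<lambda>S. real (card S) / real (card (board k d))) ` ?Sat"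
      using inner_saturated[OF assms(1)] by (rule imageI)
    show "real (card (inner k d)) / real (card (board k d)) \<le> y"
      if "y \<in> (\<lambda>S. real (card S) / real (card (board k d))) ` ?Sat" for y
      using that card_inner_le[OF assms(1)] by (auto intro: divide_right_mono)
  qed
  also have "\<dots> = ((real k - 2) / real k) ^ d"
    using assms(1) by (simp add: card_inner card_board power_divide of_nat_diff)
  also have "(real k - 2) / real k = 1 - 2 / real k"
    using assms(1) by (simp add: field_simps)
  finally show ?thesis .
qed

end
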